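(* There exists a complete metric space $M$ of cardinality continuum such that every closed separable subset of $M$ that is not a singleton fails to be a Lipschitz retract of $M$.
   Context: A map $F\colon M\to N$ between metric spaces is Lipschitz if there is a constant $C>0$ with $d(F(x),F(y))\le C\,d(x,y)$ for all $x,y\in M$. A closed subset $S$ of a metric space $M$ is a Lipschitz retract of $M$ if there is a Lipschitz map $R\colon M\to S$ (a Lipschitz retraction) with $R(x)=x$ for all $x\in S$. *)

theory Defs
  imports "HOL-Analysis.Analysis" "HOL-Library.Equipollence"
begin

definition Lipschitz_retraction :: "'a metric \<Rightarrow> 'a set \<Rightarrow> ('a \<Rightarrow> 'a) \<Rightarrow> bool"
  where "Lipschitz_retraction M S R \<longleftrightarrow>
           Lipschitz_continuous_map M (submetric M S) R \<and> (\<forall>x\<in>S. R x = x)"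

text \<open>Closedness also ensures that \<^term>\<open>S\<close> lies in the carrier of \<^term>\<open>M\<close>.\<close>

definition Lipschitz_retract_of :: "'a set \<Rightarrow> 'a metric \<Rightarrow> bool"
  where "Lipschitz_retract_of S M \<longleftrightarrow>
           closedin (mtopology_of M) S \<and> (\<exists>R. Lipschitz_retraction M S R)"

end

theory Submission
  imports Defs "HOL-Probability.Probability"
begin

text \<open>
  Take a fair coin for every node of every tree \<open>W\<close> of finite words. The first \<open>n\<close> coins along a
  word of \<open>W\<close> of length \<open>n\<close> split the probability space into \<open>2 ^ n\<close> pieces of measure \<open>2 ^ -n\<close>,
  and these splittings refine each other along \<open>W\<close>. The distance of two measurable sets is the least
  total measure of countably many pieces, coming from trees without infinite branches, which cover
  the symmetric difference up to a null set.

  Switching from \<open>A\<close> to \<open>B\<close> piece by piece gives, for every tree \<open>W\<close> without infinite branches, a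
  system of \<open>2 ^ n\<close>-step chains of step \<open>2 ^ -n\<close> from \<open>A\<close> to \<open>B\<close>, indexed by \<open>W\<close> and refining each
  other along \<open>W\<close>. But there is no infinite sequence of chains refining each other: covers used at
  consecutive scales are almost independent unless their pieces lie over a common long word,
  so following a typical point of the symmetric difference of \<open>A\<close> and \<open>B\<close> through the scales would
  produce an infinite branch of a tree that has none.

  Now let \<open>R\<close> be a Lipschitz retraction onto a separable \<open>S\<close> and \<open>a\<close>, \<open>b\<close> distinct points of \<open>S\<close>. The
  approximate chains from \<open>a\<close> to \<open>b\<close> in a countable dense subset of \<open>S\<close> form a countable tree \<open>T\<close>,
  which has no infinite branch. Taking \<open>W = T\<close> and applying \<open>R\<close> gives a map from \<open>T\<close> to \<open>T\<close> that
  sends a word to its extension by one letter; iterated from the empty word it yields an infinite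
  branch of \<open>T\<close>, a contradiction.
\<close>

section \<open>Coins on the nodes of trees\<close>

text \<open>A letter is itself a list of naturals because it will record a whole chain of points,
  given by their numbers in a countable dense set.\<close>

type_synonym word = "nat list list"
text \<open>Since the tree belongs to the index, different trees read disjoint sets of
  coins.\<close>

type_synonym index = "word set \<times> word"

definition coins :: "(index \<Rightarrow> bool) measure"
  where "coins = Pi\<^sub>M UNIV (\<lambda>_. measure_pmf (bernoulli_pmf (1/2)))"

lemma space_coins [simp]: "space coins = UNIV"
  by (simp add: coins_def space_PiM PiE_UNIV_domain)

interpretation coins: prob_space coins
  unfolding coins_def by (intro prob_space_PiM measure_pmf.prob_space_axioms)

lemma emeasure_cylinder:
  assumes "finite J"
  shows "emeasure coins {x. \<forall>j\<in>J. x j = s j} = ennreal ((1/2) ^ card J)"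
proof -
  interpret product_prob_space "\<lambda>_::index. measure_pmf (bernoulli_pmf (1/2))" UNIV
    by unfold_locales
  have "emeasure coins {x. \<forall>j\<in>J. x j = s j}
      = emeasure coins {x\<in>space coins. \<forall>j\<in>J. x j \<in> {s j}}"
    by simp
  also have "\<dots> = (\<Prod>j\<in>J. emeasure (measure_pmf (bernoulli_pmf (1/2))) {s j})"
    unfolding coins_def by (rule emeasure_PiM_Collect) (use assms in auto)
  also have "\<dots> = (\<Prod>j\<in>J. ennreal (1/2))"
  proof (rule prod.cong[OF refl])
    fix j
    show "emeasure (measure_pmf (bernoulli_pmf (1/2))) {s j} = ennreal (1/2)"
      by (cases "s j") (simp_all add: emeasure_pmf_single)
  qed
  also have "\<dots> = ennreal ((1/2) ^ card J)"
    by (simp only: prod_constant ennreal_power)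
  finally show ?thesis .
qed

lemma coordinate_in_sets [measurable]: "{x. x j} \<in> sets coins"
proof -
  have "(\<lambda>x. x j) \<in> measurable coins (measure_pmf (bernoulli_pmf (1/2)))"
    unfolding coins_def by (rule measurable_component_singleton) simp
  then have "(\<lambda>x. x j) -` {True} \<inter> space coins \<in> sets coins"
    by (rule measurable_sets) simp
  then show ?thesis by (simp add: vimage_def)
qed

lemma cylinder_in_sets:
  assumes "finite J"
  shows "{x. \<forall>j\<in>J. x j = s j} \<in> sets coins"
proof -
  have "{x. x j = s j} \<in> sets coins" for j
  proof (cases "s j")
    case False
    have "UNIV - {x. x j} \<in> sets coins"
      using sets.compl_sets[OF coordinate_in_sets, of j] by simp
    moreover have "UNIV - {x. x j} = {x. x j = s j}"
      using False by auto
    ultimately show ?thesis by simp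
  qed (use coordinate_in_sets in simp)
  then have "{x\<in>space coins. \<forall>j\<in>J. x j = s j} \<in> sets coins"
    using assms by (intro sets.sets_Collect_finite_All) auto
  then show ?thesis by simp
qed

text \<open>The first \<open>n\<close> coins along \<open>w\<close>, read as a binary number. Adding a letter to \<open>w\<close> doubles the
  number and adds one bit, so the level sets for \<open>w\<close> are halved.\<close>

fun val :: "(index \<Rightarrow> bool) \<Rightarrow> word set \<Rightarrow> word \<Rightarrow> nat \<Rightarrow> nat"
  where
    "val x W w 0 = 0"
  | "val x W w (Suc n) = 2 * val x W w n + of_bool (x (W, take (Suc n) w))"

lemma val_less: "val x W w n < 2 ^ n"
  by (induction n) auto

lemma val_take: "n \<le> m \<Longrightarrow> val x W (take m w) n = val x W w n"
  by (induction n) (auto simp: min_def)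

lemma val_eq_iff:
  "val x W w n = val y W w n \<longleftrightarrow> (\<forall>k<n. x (W, take (Suc k) w) = y (W, take (Suc k) w))"
proof (induction n)
  case (Suc n)
  have "2 * a + of_bool P = 2 * b + of_bool Q \<longleftrightarrow> a = b \<and> P = Q" for a b :: nat and P Q
    by (cases P; cases Q; simp; presburger)
  then show ?case
    using Suc by (auto simp: less_Suc_eq)
qed simp

section \<open>Pieces and their near independence\<close>

type_synonym cell = "index \<times> nat"

fun piece :: "cell \<Rightarrow> (index \<Rightarrow> bool) set"
  where "piece ((W, w), i) = {x. val x W w (length w) = i}"

text \<open>The coins that \<open>piece\<close> reads; the one at the root is not among
  them.\<close>

fun coords :: "index \<Rightarrow> index set"
  where "coords (W, w) = (\<lambda>k. (W, take (Suc k) w)) ` {..<length w}"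

lemma finite_coords [simp]: "finite (coords p)"
  by (cases p) auto

lemma inj_on_take: "inj_on (\<lambda>k. (W, take (Suc k) w)) {..<length w}"
proof (rule inj_onI)
  fix k l assume "k \<in> {..<length w}" "l \<in> {..<length w}" "(W, take (Suc k) w) = (W, take (Suc l) w)"
  then have "length (take (Suc k) w) = length (take (Suc l) w)" by simp
  then show "k = l" using \<open>k \<in> _\<close> \<open>l \<in> _\<close> by simp
qed

lemma card_coords [simp]: "card (coords p) = length (snd p)"
  by (cases p) (simp add: card_image inj_on_take)

text \<open>Binary digits are unique, so the value fixes every coin read. The point \<open>x\<close>
  rules out the empty pieces, whose number is too large for the length of the word.\<close>

lemma piece_eq_cylinder:
  assumes "x \<in> piece (p, i)"
  shows "piece (p, i) = {y. \<forall>j\<in>coords p. y j = x j}"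
proof -
  obtain W w where p: "p = (W, w)" by (cases p)
  show ?thesis
    using assms val_eq_iff[of _ W w "length w" x] unfolding p by auto
qed

declare piece.simps [simp del]

lemma piece_in_sets [measurable]: "piece c \<in> sets coins"
proof -
  obtain p i where c: "c = (p, i)" by (cases c)
  show ?thesis
  proof (cases "piece c = {}")
    case False
    then obtain x where "x \<in> piece (p, i)" using c by auto
    from piece_eq_cylinder[OF this] show ?thesis
      unfolding c by (simp add: cylinder_in_sets)
  qed simp
qed

text \<open>Pieces with a common point meet in one cylinder over the union of their coins. The bound
  is no equality because they may also be disjoint.\<close>

lemma emeasure_piece_Int:
  "emeasure coins (piece (p, i) \<inter> piece (q, j)) \<le> ennreal ((1/2) ^ card (coords p \<union> coords q))"
proof (cases "piece (p, i) \<inter> piece (q, j) = {}")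
  case False
  then obtain x where "x \<in> piece (p, i)" "x \<in> piece (q, j)" by auto
  then have "piece (p, i) \<inter> piece (q, j) = {y. \<forall>k\<in>coords p \<union> coords q. y k = x k}"
    using piece_eq_cylinder by blast
  then show ?thesis
    by (simp only: emeasure_cylinder[OF finite_UnI[OF finite_coords finite_coords]])
qed simp

lemma emeasure_piece: "emeasure coins (piece c) \<le> ennreal ((1/2) ^ length (snd (fst c)))"
  using emeasure_piece_Int[of "fst c" "snd c" "fst c" "snd c"] by simp

text \<open>A shared coin sits at a common nonempty prefix in one tree, and a common prefix longer
  than \<open>l\<close> would make the words agree up to \<open>l\<close>. So at most
  \<open>l\<close> coins are shared.\<close>

lemma coords_overlap:
  assumes "\<not> (fst p = fst q \<and> take l (snd p) = take l (snd q))"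
  shows "length (snd p) + length (snd q) \<le> card (coords p \<union> coords q) + l"
proof -
  obtain W v where p: "p = (W, v)" by (cases p)
  obtain W' w where q: "q = (W', w)" by (cases q)
  have "coords p \<inter> coords q \<subseteq> (\<lambda>k. (W, take (Suc k) v)) ` {..<l}"
  proof
    fix z assume "z \<in> coords p \<inter> coords q"
    then obtain k k' where k: "k < length v" "z = (W, take (Suc k) v)"
      and k': "k' < length w" "z = (W', take (Suc k') w)"
      unfolding p q by auto
    have W: "W = W'" and t: "take (Suc k) v = take (Suc k') w" using k k' by auto
    from arg_cong[OF t, of length] have "k = k'" using k k' by simp
    have "k < l"
    proof (rule ccontr)
      assume "\<not> k < l"
      then have "take l v = take l (take (Suc k) v)" "take l w = take l (take (Suc k') w)"
        using \<open>k = k'\<close> by (simp_all add: min_def)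
      then show False using assms W t unfolding p q by simp
    qed
    then show "z \<in> (\<lambda>k. (W, take (Suc k) v)) ` {..<l}" using k by auto
  qed
  then have "card (coords p \<inter> coords q) \<le> card ((\<lambda>k. (W, take (Suc k) v)) ` {..<l})"
    by (intro card_mono) auto
  also have "\<dots> \<le> l" using card_image_le[of "{..<l}"] by simp
  finally have "card (coords p \<inter> coords q) \<le> l" .
  moreover have "card (coords p) + card (coords q) = card (coords p \<union> coords q) + card (coords p \<inter> coords q)"
    by (rule card_Un_Int) auto
  ultimately show ?thesis by simp
qed

text \<open>Independence would give the product of the weights; every shared coin loses a factor
  2.\<close>

lemma emeasure_piece_Int_unrelated:
  assumes "\<not> (fst p = fst q \<and> take l (snd p) = take l (snd q))"
  shows "emeasure coins (piece (p, i) \<inter> piece (q, j))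
     \<le> 2 ^ l * (ennreal ((1/2) ^ length (snd p)) * ennreal ((1/2) ^ length (snd q)))"
proof -
  have "emeasure coins (piece (p, i) \<inter> piece (q, j)) \<le> ennreal ((1/2) ^ card (coords p \<union> coords q))"
    by (rule emeasure_piece_Int)
  also have "(1/2::real) ^ card (coords p \<union> coords q) = 2 ^ l * (1/2) ^ (card (coords p \<union> coords q) + l)"
    by (simp add: power_add power_one_over)
  also have "\<dots> \<le> 2 ^ l * (1/2) ^ (length (snd p) + length (snd q))"
    by (intro mult_left_mono power_decreasing coords_overlap[OF assms]) auto
  also have "\<dots> = 2 ^ l * ((1/2) ^ length (snd p) * (1/2) ^ length (snd q))"
    by (simp add: power_add)
  finally show ?thesis
    by (simp add: ennreal_mult ennreal_power ennreal_leI flip: ennreal_numeral)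
qed

section \<open>The covering cost\<close>

text \<open>The tree may be any set of words. Asking for all prefixes of the word lets growing
  compatible words trace a branch, which the second clause forbids.\<close>

definition admissible :: "index \<Rightarrow> bool"
  where "admissible p \<longleftrightarrow> (\<forall>k. take k (snd p) \<in> fst p) \<and> \<not> (\<exists>b. \<forall>n. map b [0..<n] \<in> fst p)"

text \<open>\<open>None\<close> pads sequences, so that finite covers count as well.\<close>

fun opiece :: "cell option \<Rightarrow> (index \<Rightarrow> bool) set"
  where "opiece None = {}" | "opiece (Some c) = piece c"

fun weight :: "cell option \<Rightarrow> ennreal"
  where "weight None = 0" | "weight (Some c) = ennreal ((1/2) ^ length (snd (fst c)))"

text \<open>Null sets are ignored so that sets equal up to a null set get distance zero.\<close>

definition covers :: "(index \<Rightarrow> bool) set \<Rightarrow> (nat \<Rightarrow> cell option) set"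
  where "covers A = {V. (\<forall>n c. V n = Some c \<longrightarrow> admissible (fst c)) \<and>
                        emeasure coins (A - (\<Union>n. opiece (V n))) = 0}"

definition cost :: "(index \<Rightarrow> bool) set \<Rightarrow> ennreal"
  where "cost A = (INF V\<in>covers A. \<Sum>n. weight (V n))"

lemma opiece_in_sets [measurable, simp]: "opiece c \<in> sets coins"
  by (cases c) auto

lemma UN_opiece_in_sets [simp]: "(\<Union>n::nat. opiece (V n)) \<in> sets coins"
  by (rule sets.countable_UN) auto

lemma emeasure_opiece: "emeasure coins (opiece c) \<le> weight c"
  using emeasure_piece by (cases c) simp_all

text \<open>Pieces weigh at least as much as they measure. This keeps different classes modulo null
  sets at positive distance.\<close>

lemma emeasure_le_cost:
  assumes "A \<in> sets coins"
  shows "emeasure coins A \<le> cost A"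
  unfolding cost_def
proof (rule INF_greatest)
  fix V assume V: "V \<in> covers A"
  let ?U = "\<Union>n. opiece (V n)"
  have "emeasure coins A \<le> emeasure coins ((A - ?U) \<union> ?U)"
    by (rule emeasure_mono) (blast, intro sets.Un sets.Diff assms UN_opiece_in_sets)
  also have "\<dots> \<le> emeasure coins (A - ?U) + emeasure coins ?U"
    by (intro emeasure_subadditive sets.Diff assms UN_opiece_in_sets)
  also have "\<dots> = emeasure coins (\<Union>n. opiece (V n))"
    using V by (simp add: covers_def)
  also have "\<dots> \<le> (\<Sum>n. emeasure coins (opiece (V n)))"
    by (rule emeasure_subadditive_countably) auto
  also have "\<dots> \<le> (\<Sum>n. weight (V n))"
    by (intro suminf_le emeasure_opiece) auto
  finally show "emeasure coins A \<le> (\<Sum>n. weight (V n))" .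
qed

lemma cost_mono:
  assumes "A \<subseteq> B" "B \<in> sets coins"
  shows "cost A \<le> cost B"
proof -
  have "V \<in> covers A" if V: "V \<in> covers B" for V
  proof -
    have "emeasure coins (A - (\<Union>n. opiece (V n))) \<le> emeasure coins (B - (\<Union>n. opiece (V n)))"
      using assms by (intro emeasure_mono sets.Diff UN_opiece_in_sets) auto
    also have "\<dots> = 0" using V by (simp add: covers_def)
    finally show ?thesis using V by (simp add: covers_def)
  qed
  then have "covers B \<subseteq> covers A" ..
  then show ?thesis
    unfolding cost_def by (intro INF_superset_mono) auto
qed

lemma cost_le_cover:
  assumes "V \<in> covers A"
  shows "cost A \<le> (\<Sum>n. weight (V n))"
  unfolding cost_def using assms by (rule INF_lower)

lemma cost_null:
  assumes "emeasure coins A = 0"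
  shows "cost A = 0"
  using cost_le_cover[of "\<lambda>_. None" A] assms by (simp add: covers_def)

lemma cost_eq_0_iff:
  assumes "A \<in> sets coins"
  shows "cost A = 0 \<longleftrightarrow> emeasure coins A = 0"
  using cost_null emeasure_le_cost[OF assms] by fastforce

lemma cost_piece:
  assumes "admissible p"
  shows "cost (piece (p, i)) \<le> ennreal ((1/2) ^ length (snd p))"
proof -
  define V where "V = (\<lambda>n::nat. if n = 0 then Some (p, i) else None)"
  have "piece (p, i) \<subseteq> (\<Union>n. opiece (V n))" by (intro subsetI UN_I[of 0]) (auto simp: V_def)
  then have "piece (p, i) - (\<Union>n. opiece (V n)) = {}" by blast
  then have "V \<in> covers (piece (p, i))"
    unfolding covers_def mem_Collect_eq using assms by (metis V_def emeasure_empty fst_conv option.distinct(1) option.inject)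
  from cost_le_cover[OF this] show ?thesis
    using suminf_finite[of "{0}" "\<lambda>n. weight (V n)"] by (simp add: V_def)
qed

text \<open>The tree consisting of the root alone has no branch, and one of its pieces is the whole
  space, of weight 1. Hence the distance will be real-valued.\<close>

lemma cost_le_1:
  shows "cost A \<le> 1"
proof -
  have "\<not> (\<exists>b. \<forall>n. map b [0..<n] \<in> {[]::word})"
    by (auto intro!: exI[of _ 1])
  then have adm: "admissible ({[]}, [])" by (simp add: admissible_def)
  have "cost A \<le> cost (piece (({[]}, []), 0))"
    by (rule cost_mono) (simp add: piece.simps, rule piece_in_sets)
  also have "\<dots> \<le> 1" using cost_piece[OF adm, of 0] by simp
  finally show ?thesis .
qed

lemma cost_finite [simp]: "cost A < \<top>" "cost A \<noteq> \<top>"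
  using cost_le_1[of A] by (auto simp: less_top[symmetric] top_unique)

lemma cost_near_cover:
  assumes "cost A < r"
  obtains V where "V \<in> covers A" "(\<Sum>n. weight (V n)) < r"
  using assms unfolding cost_def by (auto simp: INF_less_iff)

text \<open>Covers of \<open>A n\<close> that are optimal up to \<open>e / 2 ^ (n + 1)\<close> are
  merged into one sequence by \<open>prod_decode\<close>.\<close>

lemma cost_UN:
  assumes A: "\<And>n. A n \<in> sets coins"
  shows "cost (\<Union>n. A n) \<le> (\<Sum>n. cost (A n))"
proof (rule ennreal_le_epsilon)
  fix e :: real assume e: "0 < e"
  have "\<exists>V. V \<in> covers (A n) \<and> (\<Sum>k. weight (V k)) < cost (A n) + ennreal (e * (1/2) ^ Suc n)" for n
  proof -
    have "cost (A n) < cost (A n) + ennreal (e * (1/2) ^ Suc n)"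
      using e ennreal_add_left_cancel_less[of "cost (A n)" 0 "ennreal (e * (1/2) ^ Suc n)"]
      by (simp del: power_Suc)
    then show ?thesis using cost_near_cover[of "A n"] by metis
  qed
  then obtain V where V: "\<And>n. V n \<in> covers (A n)"
    and Vs: "\<And>n. (\<Sum>k. weight (V n k)) < cost (A n) + ennreal (e * (1/2) ^ Suc n)"
    by metis
  define U where "U = (\<lambda>i. case_prod V (prod_decode i))"
  have U: "(\<Union>i. opiece (U i)) = (\<Union>n. \<Union>k. opiece (V n k))"
  proof -
    have "(\<Union>i. opiece (U i)) = (\<Union>p\<in>range prod_decode. opiece (case_prod V p))"
      by (simp add: U_def)
    then show ?thesis by (simp add: surj_prod_decode UN_UN_split_split_eq) (simp add: UNION_eq)
  qed
  have "emeasure coins ((\<Union>n. A n) - (\<Union>i. opiece (U i))) \<le>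
        emeasure coins (\<Union>n. A n - (\<Union>k. opiece (V n k)))"
    unfolding U using A by (intro emeasure_mono sets.countable_UN sets.Diff) auto
  also have "\<dots> \<le> (\<Sum>n. emeasure coins (A n - (\<Union>k. opiece (V n k))))"
    using A by (intro emeasure_subadditive_countably image_subsetI sets.countable_UN sets.Diff) auto
  also have "\<dots> = 0" using V by (simp add: covers_def)
  finally have "emeasure coins ((\<Union>n. A n) - (\<Union>i. opiece (U i))) = 0"
    by simp
  moreover have "admissible (fst c)" if "U i = Some c" for i c
  proof -
    have "V (fst (prod_decode i)) (snd (prod_decode i)) = Some c"
      using that by (simp add: U_def case_prod_unfold)
    then show ?thesis
      using V[of "fst (prod_decode i)"] unfolding covers_def by blast
  qed
  ultimately have "U \<in> covers (\<Union>n. A n)"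
    unfolding covers_def by blast
  then have "cost (\<Union>n. A n) \<le> (\<Sum>i. weight (U i))"
    by (rule cost_le_cover)
  also have "\<dots> = (\<Sum>n. \<Sum>k. weight (V n k))"
    using suminf_ennreal_2dimen[of "\<lambda>n. \<Sum>k. weight (V n k)" "\<lambda>(n,k). weight (V n k)"]
    by (simp add: U_def case_prod_unfold)
  also have "\<dots> \<le> (\<Sum>n. cost (A n) + ennreal (e * (1/2) ^ Suc n))"
    by (intro suminf_le less_imp_le[OF Vs]) auto
  also have "\<dots> = (\<Sum>n. cost (A n)) + (\<Sum>n. ennreal (e * (1/2) ^ Suc n))"
    by (intro suminf_add[symmetric]) auto
  also have "(\<Sum>n. ennreal (e * (1/2) ^ Suc n)) = ennreal e"
  proof (rule suminf_ennreal_eq)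
    show "(\<lambda>n. e * (1/2) ^ Suc n) sums e"
      using sums_mult[OF power_half_series, of e] by simp
  qed (use e in simp)
  finally show "cost (\<Union>n. A n) \<le> (\<Sum>n. cost (A n)) + ennreal e" .
qed

lemma cost_Un:
  assumes "A \<in> sets coins" "B \<in> sets coins"
  shows "cost (A \<union> B) \<le> cost A + cost B"
proof -
  define F where "F = (\<lambda>n::nat. if n = 0 then A else if n = 1 then B else {})"
  have "(\<Union>n. F n) = A \<union> B" by (auto simp: F_def split: if_splits)
  moreover have "(\<Sum>n. cost (F n)) = (\<Sum>n\<in>{0,1}. cost (F n))"
    by (rule suminf_finite) (auto simp: F_def cost_null)
  ultimately show ?thesis
    using cost_UN[of F] assms by (simp add: F_def)
qed

section \<open>Absence of dyadic Lipschitz curves\<close>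

text \<open>Weighs the loss \<open>2 ^ l\<close> for \<open>l = n div 2\<close> against
  \<open>2 ^ -n\<close>; 3/4 is a rational above the square root of 1/2.\<close>

lemma half_power_div_2_le: "(2::real) ^ (n div 2) * (1/2) ^ n \<le> (3/4) ^ n"
proof -
  have *: "(2::real) ^ k * (1/2) ^ (2 * k) \<le> (3/4) ^ (2 * k)" for k
  proof -
    have "(2::real) ^ k * (1/2) ^ (2 * k) = (1/2) ^ k"
      by (simp add: power_mult power_mult_distrib[symmetric] power2_eq_square)
    also have "\<dots> \<le> (9/16) ^ k" by (intro power_mono) auto
    also have "\<dots> = (3/4) ^ (2 * k)" by (simp add: power_mult power2_eq_square)
    finally show ?thesis .
  qed
  show ?thesis
  proof (cases "even n")
    case True
    then show ?thesis using *[of "n div 2"] by simp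
  next
    case False
    then obtain k where n: "n = 2 * k + 1" by (elim oddE)
    have "(2::real) ^ (n div 2) * (1/2) ^ n = 1/2 * (2 ^ k * (1/2) ^ (2 * k))"
      by (simp add: n)
    also have "\<dots> \<le> 3/4 * (3/4) ^ (2 * k)"
      using *[of k] by (intro mult_mono) auto
    also have "\<dots> = (3/4) ^ n" by (simp add: n)
    finally show ?thesis .
  qed
qed

lemma two_power_mult_ennreal:
  "0 \<le> a \<Longrightarrow> 0 \<le> b \<Longrightarrow> 2 ^ l * (ennreal a * ennreal b) = ennreal (2 ^ l * (a * b))"
  by (simp add: ennreal_mult ennreal_power flip: ennreal_numeral)

text \<open>Two pieces over words that part before length \<open>l\<close> are independent up to a factor \<open>2 ^ l\<close>.\<close>

fun unrelated :: "nat \<Rightarrow> cell option \<Rightarrow> cell option \<Rightarrow> bool"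
  where
    "unrelated l (Some (p, i)) (Some (q, j)) \<longleftrightarrow>
       \<not> (fst p = fst q \<and> take l (snd p) = take l (snd q))"
  | "unrelated l _ _ \<longleftrightarrow> False"

definition unrelated_overlap ::
    "nat \<Rightarrow> (nat \<Rightarrow> cell option) \<Rightarrow> (nat \<Rightarrow> cell option) \<Rightarrow> (index \<Rightarrow> bool) set"
  where "unrelated_overlap l U V =
    (\<Union>s. \<Union>t. if unrelated l (U s) (V t) then opiece (U s) \<inter> opiece (V t) else {})"

lemma unrelated_overlap_in_sets [simp]: "unrelated_overlap l U V \<in> sets coins"
  unfolding unrelated_overlap_def
  by (intro sets.countable_UN image_subsetI) auto

lemma emeasure_opiece_Int_unrelated:
  assumes "unrelated l c d"
  shows "emeasure coins (opiece c \<inter> opiece d) \<le> 2 ^ l * (weight c * weight d)"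
  using assms emeasure_piece_Int_unrelated
  by (cases "(l, c, d)" rule: unrelated.cases) simp_all

lemma emeasure_unrelated_overlap:
  "emeasure coins (unrelated_overlap l U V) \<le> 2 ^ l * ((\<Sum>s. weight (U s)) * (\<Sum>t. weight (V t)))"
proof -
  let ?X = "\<lambda>s t. if unrelated l (U s) (V t) then opiece (U s) \<inter> opiece (V t) else {}"
  have X: "emeasure coins (?X s t) \<le> 2 ^ l * (weight (U s) * weight (V t))" for s t
    using emeasure_opiece_Int_unrelated[of l "U s" "V t"] by simp
  have "emeasure coins (unrelated_overlap l U V) \<le> (\<Sum>s. emeasure coins (\<Union>t. ?X s t))"
    unfolding unrelated_overlap_def
    by (intro emeasure_subadditive_countably image_subsetI sets.countable_UN) auto
  also have "\<dots> \<le> (\<Sum>s. \<Sum>t. emeasure coins (?X s t))"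
    by (intro suminf_le emeasure_subadditive_countably image_subsetI) auto
  also have "\<dots> \<le> (\<Sum>s. \<Sum>t. 2 ^ l * (weight (U s) * weight (V t)))"
    by (intro suminf_le X) auto
  also have "\<dots> = 2 ^ l * ((\<Sum>s. weight (U s)) * (\<Sum>t. weight (V t)))"
    by (simp add: ennreal_suminf_cmult ennreal_suminf_multc)
  finally show ?thesis .
qed

lemma ex_consecutive_change:
  fixes P :: "nat \<Rightarrow> bool"
  assumes "P 0 \<noteq> P n"
  obtains i where "i < n" "P i \<noteq> P (Suc i)"
proof -
  have "\<exists>i<n. P i \<noteq> P (Suc i)"
  proof (rule ccontr)
    assume "\<not> ?thesis"
    then have *: "P (Suc i) = P i" if "i < n" for i using that by blast
    have "i \<le> n \<Longrightarrow> P i = P 0" for i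
    proof (induction i)
      case (Suc i)
      then show ?case using *[of i] by simp
    qed simp
    from this[of n] show False using assms by simp
  qed
  then show ?thesis using that by blast
qed

text \<open>The length up to which consecutive words agree tends to infinity without ever
  decreasing, so the prefixes settle and have a limit.\<close>

lemma branch_of_compatible_words:
  assumes len: "\<And>k. length (w k) \<ge> (n0 + k) div 2"
    and comp: "\<And>k. take ((n0 + k) div 2) (w k) = take ((n0 + k) div 2) (w (Suc k))"
  shows "\<exists>b. \<forall>n. \<exists>k. map b [0..<n] = take n (w k)"
proof -
  have far: "take ((n0 + k) div 2) (w (k + j)) = take ((n0 + k) div 2) (w k)" for k j
  proof (induction j)
    case (Suc j)
    have le: "(n0 + k) div 2 \<le> (n0 + (k + j)) div 2" by (intro div_le_mono) simp
    have "take ((n0 + k) div 2) (w (k + Suc j))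
        = take ((n0 + k) div 2) (take ((n0 + (k + j)) div 2) (w (Suc (k + j))))"
      using le by (simp add: min_def)
    also have "\<dots> = take ((n0 + k) div 2) (w (k + j))"
      using le comp[of "k + j"] by (metis min_def take_take)
    finally show ?case using Suc by simp
  qed simp
  \<comment> \<open>Word \<open>2 * i + 2\<close> has settled on at least its first
    \<open>i + 1\<close> letters, so position \<open>i\<close> can be read there.\<close>
  define b where "b i = w (2 * i + 2) ! i" for i
  have "map b [0..<n] = take n (w (2 * n + 2))" for n
  proof (rule nth_equalityI)
    show len': "length (map b [0..<n]) = length (take n (w (2 * n + 2)))"
      using len[of "2 * n + 2"] by simp
    fix i assume "i < length (map b [0..<n])"
    then have i: "i < n" by simp
    have "w (2 * i + 2) ! i = take ((n0 + (2 * i + 2)) div 2) (w (2 * i + 2)) ! i"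
      by simp
    also have "\<dots> = take ((n0 + (2 * i + 2)) div 2) (w ((2 * i + 2) + 2 * (n - i))) ! i"
      by (simp only: far)
    also have "\<dots> = w (2 * n + 2) ! i"
      using i by (simp add: algebra_simps)
    finally show "map b [0..<n] ! i = take n (w (2 * n + 2)) ! i"
      using i by (simp add: b_def)
  qed
  then show ?thesis by blast
qed

text \<open>The exceptional sets \<open>G n\<close> have geometrically small measure, so from some
  scale on they cannot exhaust a symmetric difference of positive measure. A point outside all of
  them picks compatible pieces at all scales.\<close>

lemma no_dyadic_Lipschitz_curve:
  fixes q :: "nat \<Rightarrow> nat \<Rightarrow> (index \<Rightarrow> bool) set" and L :: real
  assumes q: "\<And>n i. q n i \<in> sets coins" and A: "A \<in> sets coins" and B: "B \<in> sets coins"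
    and step: "\<And>n i. i < 2 ^ n \<Longrightarrow> cost (sym_diff (q n i) (q n (Suc i))) < ennreal (L * (1/2) ^ n)"
    and refine: "\<And>n i. i \<le> 2 ^ n \<Longrightarrow> cost (sym_diff (q n i) (q (Suc n) (2 * i))) \<le> ennreal ((1/4) ^ n)"
    and ends: "\<And>n. cost (sym_diff A (q n 0)) \<le> ennreal ((1/4) ^ n)"
      "\<And>n. cost (sym_diff (q n (2 ^ n)) B) \<le> ennreal ((1/4) ^ n)"
  shows "emeasure coins (sym_diff A B) = 0"
proof (rule ccontr)
  assume pos: "emeasure coins (sym_diff A B) \<noteq> 0"
  have L: "0 < L" using step[of 0 0] by (cases "0 < L") (auto simp: ennreal_neg)
  define D where "D n i = sym_diff (q n i) (q n (Suc i))" for n i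
  have D: "D n i \<in> sets coins" for n i using q by (simp add: D_def sets.Un sets.Diff)
  have "\<exists>V. i < 2 ^ n \<longrightarrow> V \<in> covers (D n i) \<and> (\<Sum>s. weight (V s)) < ennreal (L * (1/2) ^ n)" for n i
    using step[of i n] cost_near_cover[of "D n i"] unfolding D_def by metis
  then have "\<forall>n i. \<exists>V. i < 2 ^ n \<longrightarrow> V \<in> covers (D n i) \<and> (\<Sum>s. weight (V s)) < ennreal (L * (1/2) ^ n)"
    by blast
  then obtain V where *: "\<forall>n i. i < 2 ^ n \<longrightarrow> V n i \<in> covers (D n i) \<and> (\<Sum>s. weight (V n i s)) < ennreal (L * (1/2) ^ n)"
    unfolding choice_iff by blast
  have V: "V n i \<in> covers (D n i)" and Vsum: "(\<Sum>s. weight (V n i s)) < ennreal (L * (1/2) ^ n)"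
    if "i < 2 ^ n" for n i
    using * that by blast+
  \<comment> \<open>Points where the covers at scales \<open>n\<close> and \<open>n + 1\<close> use unrelated pieces.\<close>
  define X where "X n i j = unrelated_overlap (n div 2) (V n i) (V (Suc n) (2 * i + j))" for n i j
  \<comment> \<open>The factor \<open>(1/2) ^ n\<close> pays for the \<open>2 ^ n\<close> values of
    \<open>i\<close>; what remains is summable over \<open>n\<close>.\<close>
  have X: "emeasure coins (X n i j) \<le> ennreal (L\<^sup>2 * (1/2) * (3/4) ^ n * (1/2) ^ n)"
    if "i < 2 ^ n" "j \<le> 1" for n i j
  proof -
    have j: "2 * i + j < 2 ^ Suc n" using that by simp
    have "emeasure coins (X n i j) \<le>
        2 ^ (n div 2) * ((\<Sum>s. weight (V n i s)) * (\<Sum>t. weight (V (Suc n) (2 * i + j) t)))"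
      unfolding X_def by (rule emeasure_unrelated_overlap)
    also have "\<dots> \<le> 2 ^ (n div 2) * (ennreal (L * (1/2) ^ n) * ennreal (L * (1/2) ^ Suc n))"
      by (intro mult_left_mono mult_mono less_imp_le[OF Vsum] that j) auto
    also have "\<dots> = ennreal (2 ^ (n div 2) * ((L * (1/2) ^ n) * (L * (1/2) ^ Suc n)))"
      using L by (intro two_power_mult_ennreal) auto
    also have "2 ^ (n div 2) * ((L * (1/2) ^ n) * (L * (1/2) ^ Suc n))
        = L\<^sup>2 * (1/2) * (2 ^ (n div 2) * (1/2) ^ n) * (1/2) ^ n"
      by (simp add: power2_eq_square)
    also have "\<dots> \<le> L\<^sup>2 * (1/2) * (3/4) ^ n * (1/2) ^ n"
      by (intro mult_right_mono mult_left_mono half_power_div_2_le) auto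
    finally show ?thesis by (simp add: ennreal_leI)
  qed
  define N where "N n i = D n i - (\<Union>s. opiece (V n i s))" for n i
  have N: "emeasure coins (N n i) = 0" if "i < 2 ^ n" for n i
    using V[OF that] by (simp add: covers_def N_def)
  define E where "E n i = sym_diff (q n i) (q (Suc n) (2 * i))" for n i
  \<comment> \<open>All that can go wrong at scale \<open>n\<close>: unrelated covers, uncovered
    points, disagreement with scale \<open>n + 1\<close> or with the two ends.\<close>
  define G where "G n = (\<Union>i\<in>{..<2^n}. X n i 0 \<union> X n i 1 \<union> N n i) \<union> (\<Union>i\<in>{..2^n}. E n i)
      \<union> (sym_diff A (q n 0) \<union> sym_diff (q n (2 ^ n)) B)" for n
  have small: "emeasure coins (E n i) \<le> ennreal ((1/4) ^ n)" if "i \<le> 2 ^ n" for n i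
    unfolding E_def using refine[OF that] emeasure_le_cost[of "sym_diff (q n i) (q (Suc n) (2 * i))"]
    by (meson order_trans sets.Un sets.Diff q)
  have small_ends: "emeasure coins (sym_diff A (q n 0)) \<le> ennreal ((1/4) ^ n)"
    "emeasure coins (sym_diff (q n (2 ^ n)) B) \<le> ennreal ((1/4) ^ n)" for n
    using ends emeasure_le_cost by (meson order_trans sets.Un sets.Diff q A B)+
  have sX: "X n i j \<in> sets coins" and sN: "N n i \<in> sets coins" and sE: "E n i \<in> sets coins" for n i j
    using q D by (auto simp: X_def N_def E_def intro!: sets.Diff)
  have sends: "sym_diff A (q n 0) \<in> sets coins" "sym_diff (q n (2 ^ n)) B \<in> sets coins" for n
    using q A B by auto
  have sG: "G n \<in> sets coins" for n
    unfolding G_def by (intro sets.Un sets.finite_UN sX sN sE sends) auto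
  have G: "emeasure coins (G n) \<le> ennreal ((L\<^sup>2 + 4) * (3/4) ^ n)" for n
  proof -
    let ?x = "L\<^sup>2 * (1/2) * (3/4) ^ n * (1/2) ^ n"
    have "emeasure coins (X n i 0 \<union> X n i 1 \<union> N n i) \<le> ennreal (2 * ?x)" if "i < 2 ^ n" for i
    proof -
      have "emeasure coins (X n i 0 \<union> X n i 1 \<union> N n i) \<le> emeasure coins (X n i 0 \<union> X n i 1) + emeasure coins (N n i)"
        by (intro emeasure_subadditive sets.Un sX sN)
      also have "\<dots> = emeasure coins (X n i 0 \<union> X n i 1)" using N[OF that] by simp
      also have "\<dots> \<le> emeasure coins (X n i 0) + emeasure coins (X n i 1)"
        by (intro emeasure_subadditive sX)
      also have "\<dots> \<le> ennreal ?x + ennreal ?x"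
        by (intro add_mono X that) auto
      also have "\<dots> = ennreal (2 * ?x)" by (simp flip: ennreal_plus)
      finally show ?thesis .
    qed
    then have "(\<Sum>i\<in>{..<2^n}. emeasure coins (X n i 0 \<union> X n i 1 \<union> N n i)) \<le> (\<Sum>i\<in>{..<2^n::nat}. ennreal (2 * ?x))"
      by (intro sum_mono) auto
    also have "\<dots> = ennreal (L\<^sup>2 * (3/4) ^ n)"
      by (simp add: ennreal_mult[symmetric] ennreal_of_nat_eq_real_of_nat power_one_over field_simps)
    finally have 1: "emeasure coins (\<Union>i\<in>{..<2^n}. X n i 0 \<union> X n i 1 \<union> N n i) \<le> ennreal (L\<^sup>2 * (3/4) ^ n)"
      by (rule order_trans[OF emeasure_subadditive_finite, rotated 2])
         (auto intro!: sets.Un sX sN)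
    \<comment> \<open>There are about \<open>2 ^ n\<close> discrepancies; the tolerance
      \<open>(1/4) ^ n\<close> leaves a summable total.\<close>
    have "(\<Sum>i\<in>{..2^n}. emeasure coins (E n i)) \<le> (\<Sum>i\<in>{..2^n::nat}. ennreal ((1/4) ^ n))"
      by (intro sum_mono small) auto
    also have "\<dots> = ennreal ((2 ^ n + 1) * (1/4) ^ n)"
      by (simp add: ennreal_mult[symmetric] ennreal_of_nat_eq_real_of_nat flip: ennreal_plus)
    finally have 2: "emeasure coins (\<Union>i\<in>{..2^n}. E n i) \<le> ennreal ((2 ^ n + 1) * (1/4) ^ n)"
      by (rule order_trans[OF emeasure_subadditive_finite, rotated 2]) (auto intro!: sE)
    have 3: "emeasure coins (sym_diff A (q n 0) \<union> sym_diff (q n (2 ^ n)) B) \<le> ennreal ((1/4) ^ n) + ennreal ((1/4) ^ n)"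
      by (rule order_trans[OF emeasure_subadditive[OF sends] add_mono[OF small_ends]])
    have "emeasure coins (G n) \<le> emeasure coins ((\<Union>i\<in>{..<2^n}. X n i 0 \<union> X n i 1 \<union> N n i) \<union> (\<Union>i\<in>{..2^n}. E n i))
       + emeasure coins (sym_diff A (q n 0) \<union> sym_diff (q n (2 ^ n)) B)"
      unfolding G_def by (intro emeasure_subadditive sets.Un[OF sends] sets.Un sets.finite_UN sX sN sE) auto
    also have "\<dots> \<le> (emeasure coins (\<Union>i\<in>{..<2^n}. X n i 0 \<union> X n i 1 \<union> N n i) + emeasure coins (\<Union>i\<in>{..2^n}. E n i))
       + emeasure coins (sym_diff A (q n 0) \<union> sym_diff (q n (2 ^ n)) B)"
      by (intro add_right_mono emeasure_subadditive sets.Un sets.finite_UN sX sN sE) auto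
    also have "\<dots> \<le> (ennreal (L\<^sup>2 * (3/4) ^ n) + ennreal ((2 ^ n + 1) * (1/4) ^ n)) + (ennreal ((1/4) ^ n) + ennreal ((1/4) ^ n))"
      by (intro add_mono 1 2 3)
    also have "\<dots> = ennreal (L\<^sup>2 * (3/4) ^ n + (2 ^ n + 3) * (1/4) ^ n)"
      by (simp add: algebra_simps flip: ennreal_plus)
    also have "\<dots> \<le> ennreal ((L\<^sup>2 + 4) * (3/4) ^ n)"
    proof (rule ennreal_leI)
      have "(2 ^ n + 3) * (1/4::real) ^ n \<le> (4 * 2 ^ n) * (1/4) ^ n"
        by (intro mult_right_mono) auto
      also have "\<dots> = 4 * (1/2) ^ n"
        by (simp add: power_mult_distrib[symmetric])
      also have "\<dots> \<le> 4 * (3/4) ^ n" by (intro mult_left_mono power_mono) auto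
      finally show "L\<^sup>2 * (3/4) ^ n + (2 ^ n + 3) * (1/4) ^ n \<le> (L\<^sup>2 + 4) * (3/4) ^ n"
        by (simp add: algebra_simps)
    qed
    finally show ?thesis .
  qed

  obtain m where m: "0 < m" "emeasure coins (sym_diff A B) = ennreal m"
    using pos by (metis coins.emeasure_eq_measure ennreal_0 measure_nonneg less_eq_real_def)
  \<comment> \<open>One limit serves two demands on \<open>n0\<close>: the geometric tail, whence
    the factor \<open>4 = 1 / (1 - 3/4)\<close>, stays below \<open>m\<close>, and
    \<open>L * (3/4) ^ n < 1\<close> will force long words.\<close>
  have "(\<lambda>n. (4 * (L\<^sup>2 + 4) + L) * (3/4::real) ^ n) \<longlonglongrightarrow> (4 * (L\<^sup>2 + 4) + L) * 0"
    by (intro tendsto_intros LIMSEQ_power_zero) auto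
  then have "\<forall>\<^sub>F n in sequentially. (4 * (L\<^sup>2 + 4) + L) * (3/4::real) ^ n < min m 1"
    using m by (intro order_tendstoD(2)) auto
  then obtain n0 where "\<And>n. n \<ge> n0 \<Longrightarrow> (4 * (L\<^sup>2 + 4) + L) * (3/4::real) ^ n < min m 1"
    by (auto simp: eventually_sequentially)
  then have n0: "4 * (L\<^sup>2 + 4) * (3/4) ^ n0 < m" and n0': "\<And>n. n \<ge> n0 \<Longrightarrow> L * (3/4) ^ n < 1"
  proof -
    assume *: "\<And>n. n \<ge> n0 \<Longrightarrow> (4 * (L\<^sup>2 + 4) + L) * (3/4::real) ^ n < min m 1"
    have "L * (3/4) ^ n0 \<ge> 0" using L by simp
    then show "4 * (L\<^sup>2 + 4) * (3/4) ^ n0 < m" using *[of n0] by (simp add: algebra_simps)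
    fix n assume "n \<ge> n0"
    have "L * (3/4) ^ n \<le> (4 * (L\<^sup>2 + 4) + L) * (3/4::real) ^ n"
      by (intro mult_right_mono) auto
    also have "\<dots> < min m 1" by (rule *) fact
    finally show "L * (3/4) ^ n < 1" by simp
  qed
  have "emeasure coins (\<Union>k. G (n0 + k)) \<le> (\<Sum>k. emeasure coins (G (n0 + k)))"
    using sG by (intro emeasure_subadditive_countably) auto
  also have "\<dots> \<le> (\<Sum>k. ennreal ((L\<^sup>2 + 4) * (3/4) ^ (n0 + k)))"
    by (intro suminf_le G) auto
  also have "\<dots> = ennreal (4 * (L\<^sup>2 + 4) * (3/4) ^ n0)"
  proof (rule suminf_ennreal_eq)
    have "(\<lambda>k. (L\<^sup>2 + 4) * (3/4) ^ n0 * (3/4::real) ^ k) sums ((L\<^sup>2 + 4) * (3/4) ^ n0 * (1 / (1 - 3/4)))"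
      by (intro sums_mult geometric_sums) auto
    then show "(\<lambda>k. (L\<^sup>2 + 4) * (3/4) ^ (n0 + k)) sums (4 * (L\<^sup>2 + 4) * (3/4) ^ n0)"
      by (simp add: power_add algebra_simps)
  qed simp
  also have "\<dots> < emeasure coins (sym_diff A B)"
    using n0 m by (simp add: ennreal_less_iff)
  finally have "\<not> sym_diff A B \<subseteq> (\<Union>k. G (n0 + k))"
    using emeasure_mono[of "sym_diff A B" "\<Union>k. G (n0 + k)" coins] sG
    by (meson leD sets.countable_UN image_subsetI)
  then obtain x where x: "x \<in> sym_diff A B" and xG: "\<And>k. x \<notin> G (n0 + k)" by blast

  \<comment> \<open>Outside \<open>G n0\<close> the ends of the chain agree with \<open>A\<close>
    and \<open>B\<close> at \<open>x\<close>, so membership of \<open>x\<close> changes along the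
    chain.\<close>
  have "(x \<in> q n0 0) \<noteq> (x \<in> q n0 (2 ^ n0))"
    using x xG[of 0] by (auto simp: G_def)
  then obtain i0 where i0: "i0 < 2 ^ n0" "x \<in> D n0 i0"
    using ex_consecutive_change[of "\<lambda>i. x \<in> q n0 i" "2 ^ n0"] unfolding D_def by blast
  \<comment> \<open>At \<open>x\<close> the points \<open>i\<close> and \<open>i + 1\<close> agree
    with \<open>2 * i\<close> and \<open>2 * i + 2\<close> one scale finer, so the change happens in
    one of the two half-steps.\<close>
  have next_i: "\<exists>i'. (i' < 2 ^ (n0 + Suc k) \<and> x \<in> D (n0 + Suc k) i') \<and> (\<exists>j\<le>1. i' = 2 * i + j)"
    if i: "i < 2 ^ (n0 + k) \<and> x \<in> D (n0 + k) i" for i k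
  proof -
    let ?n = "n0 + k"
    have E1: "x \<notin> E ?n i" "x \<notin> E ?n (Suc i)"
      using xG[of k] i unfolding G_def by auto
    have "(x \<in> q (Suc ?n) (2 * i)) \<noteq> (x \<in> q (Suc ?n) (Suc (Suc (2 * i))))"
      using E1 i unfolding E_def D_def by auto
    then have "x \<in> D (Suc ?n) (2 * i) \<or> x \<in> D (Suc ?n) (2 * i + 1)"
      unfolding D_def by auto
    then obtain j where "j \<le> 1" "x \<in> D (Suc ?n) (2 * i + j)"
      by (metis add.right_neutral le_refl zero_le_one)
    moreover have "2 * i + j < 2 ^ (n0 + Suc k)" using i \<open>j \<le> 1\<close> by simp
    ultimately show ?thesis by auto
  qed
  obtain f where f: "\<And>k. f k < 2 ^ (n0 + k) \<and> x \<in> D (n0 + k) (f k)"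
    and f_next: "\<And>k. \<exists>j\<le>1. f (Suc k) = 2 * f k + j"
    using dependent_nat_choice[of "\<lambda>k i. i < 2 ^ (n0 + k) \<and> x \<in> D (n0 + k) i" "\<lambda>k i i'. \<exists>j\<le>1. i' = 2 * i + j"]
      i0 next_i by (metis add.right_neutral)
  have "\<exists>c s. x \<in> piece c \<and> V (n0 + k) (f k) s = Some c" for k
  proof -
    have "x \<notin> N (n0 + k) (f k)" using xG[of k] f[of k] unfolding G_def by auto
    then obtain s where s: "x \<in> opiece (V (n0 + k) (f k) s)"
      using f[of k] unfolding N_def by auto
    then show ?thesis by (cases "V (n0 + k) (f k) s") auto
  qed
  then obtain c s where c: "\<And>k. x \<in> piece (c k)" and s: "\<And>k. V (n0 + k) (f k) (s k) = Some (c k)"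
    by metis
  have adm: "admissible (fst (c k))" for k
    using V[of "f k" "n0 + k"] f[of k] s[of k] unfolding covers_def by blast
  \<comment> \<open>A single piece weighs less than \<open>L * (1/2) ^ n\<close>, while a word
    shorter than \<open>n div 2\<close> would weigh at least
    \<open>(1/2) ^ (n div 2)\<close>.\<close>
  have len: "length (snd (fst (c k))) \<ge> (n0 + k) div 2" for k
  proof (rule ccontr)
    let ?n = "n0 + k"
    assume "\<not> ?thesis"
    then have "(1/2::real) ^ (?n div 2) \<le> (1/2) ^ length (snd (fst (c k)))"
      by (intro power_decreasing) auto
    moreover have "ennreal ((1/2) ^ length (snd (fst (c k)))) < ennreal (L * (1/2) ^ ?n)"
    proof -
      have "weight (V ?n (f k) (s k)) \<le> (\<Sum>t. weight (V ?n (f k) t))"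
        using sum_le_suminf[of "\<lambda>t. weight (V ?n (f k) t)" "{s k}"] by simp
      also have "\<dots> < ennreal (L * (1/2) ^ ?n)" using Vsum f by blast
      finally show ?thesis by (simp add: s)
    qed
    then have "(1/2::real) ^ length (snd (fst (c k))) < L * (1/2) ^ ?n"
      by (subst (asm) ennreal_less_iff) auto
    ultimately have "(1/2::real) ^ (?n div 2) < L * (1/2) ^ ?n"
      by (rule order_le_less_trans)
    then have "2 ^ (?n div 2) * (1/2::real) ^ (?n div 2) < 2 ^ (?n div 2) * (L * (1/2) ^ ?n)"
      by (intro mult_strict_left_mono) auto
    then have "1 < L * (2 ^ (?n div 2) * (1/2) ^ ?n)"
      by (simp add: power_mult_distrib[symmetric] algebra_simps)
    also have "\<dots> \<le> L * (3/4) ^ ?n"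
      using L by (intro mult_left_mono half_power_div_2_le) auto
    finally show False using n0'[of ?n] by simp
  qed
  have related: "fst (fst (c k)) = fst (fst (c (Suc k))) \<and>
      take ((n0 + k) div 2) (snd (fst (c k))) = take ((n0 + k) div 2) (snd (fst (c (Suc k))))" for k
  proof -
    obtain j where j: "j \<le> 1" "f (Suc k) = 2 * f k + j" using f_next by blast
    have "x \<notin> X (n0 + k) (f k) j"
      using xG[of k] f[of k] j by (auto simp: G_def le_Suc_eq)
    moreover have "x \<in> opiece (V (n0 + k) (f k) (s k))" "x \<in> opiece (V (Suc (n0 + k)) (2 * f k + j) (s (Suc k)))"
      using s[of k] s[of "Suc k"] c[of k] c[of "Suc k"] j by simp_all
    ultimately have "\<not> unrelated ((n0 + k) div 2) (V (n0 + k) (f k) (s k)) (V (Suc (n0 + k)) (2 * f k + j) (s (Suc k)))"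
      unfolding X_def unrelated_overlap_def by auto
    then have "\<not> unrelated ((n0 + k) div 2) (Some (c k)) (Some (c (Suc k)))"
      using s[of k] s[of "Suc k"] j by simp
    then show ?thesis by (cases "c k"; cases "c (Suc k)") auto
  qed
  have W: "fst (fst (c k)) = fst (fst (c 0))" for k
    using related by (induction k) auto
  obtain b where "\<And>n. \<exists>k. map b [0..<n] = take n (snd (fst (c k)))"
    using branch_of_compatible_words[of n0 "\<lambda>k. snd (fst (c k))"] related len by blast
  \<comment> \<open>Each initial part of \<open>b\<close> is a prefix of an admissible word, and all
    these words belong to the same tree.\<close>
  then have "map b [0..<n] \<in> fst (fst (c 0))" for n
    using adm W unfolding admissible_def by metis
  then show False using adm[of 0] unfolding admissible_def by blast
qed

section \<open>Cardinality of the \<open>\<sigma>\<close>-algebra\<close>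

text \<open>Syntax trees for members of a generated sigma-algebra; counting the trees avoids a
  transfinite recursion.\<close>

datatype 'b sigma_code =
    Basic 'b
  | Empty
  | Complement "'b sigma_code"
  | Countable_Union "nat \<Rightarrow> 'b sigma_code"

primrec eval_code :: "'a set \<Rightarrow> ('b \<Rightarrow> 'a set) \<Rightarrow> 'b sigma_code \<Rightarrow> 'a set"
  where
    "eval_code \<Omega> g (Basic b) = g b"
  | "eval_code \<Omega> g Empty = {}"
  | "eval_code \<Omega> g (Complement t) = \<Omega> - eval_code \<Omega> g t"
  | "eval_code \<Omega> g (Countable_Union f) = (\<Union>n. eval_code \<Omega> g (f n))"

text \<open>A code is determined by the labels met along all finite paths through its syntax tree.\<close>

primrec labels :: "nat set sigma_code \<Rightarrow> nat list \<Rightarrow> nat set"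
  where
    "labels (Basic b) p = insert 0 (Suc ` b)"
  | "labels Empty p = {}"
  | "labels (Complement t) p = (case p of [] \<Rightarrow> {1} | n # p' \<Rightarrow> labels t p')"
  | "labels (Countable_Union f) p = (case p of [] \<Rightarrow> {2} | n # p' \<Rightarrow> labels (f n) p')"

text \<open>The label at the root reveals the constructor, and for \<open>Basic\<close> also its
  argument, shifted by \<open>Suc\<close> to keep 0 as a tag. Longer paths reveal the
  subtrees.\<close>

lemma labels_inject: "labels s = labels t \<Longrightarrow> s = t"
proof (induction s arbitrary: t)
  case (Basic b)
  from fun_cong[OF Basic, of "[]"] show ?case
    by (cases t) (auto dest: insert_ident[THEN iffD1, rotated 2])
next
  case Empty
  from fun_cong[OF Empty, of "[]"] show ?case by (cases t) auto
next
  case (Complement s)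
  from fun_cong[OF Complement.prems, of "[]"] obtain t' where t: "t = Complement t'"
    by (cases t) auto
  have "labels s = labels t'"
    using fun_cong[OF Complement.prems, of "0 # _"] by (auto simp: t)
  then show ?case using Complement.IH t by simp
next
  case (Countable_Union f)
  from fun_cong[OF Countable_Union.prems, of "[]"] obtain g where t: "t = Countable_Union g"
    by (cases t) auto
  have "labels (f n) = labels (g n)" for n
    using fun_cong[OF Countable_Union.prems, of "n # _"] by (auto simp: t)
  then have "f n = g n" for n using Countable_Union.IH by auto
  then show ?case using t by auto
qed

lemma inj_graph_encoding:
  "inj (\<lambda>(F :: 'a::countable \<Rightarrow> nat set). {prod_encode (to_nat p, m) | p m. m \<in> F p})"
proof (rule injI)
  fix F G :: "'a \<Rightarrow> nat set"
  assume eq: "{prod_encode (to_nat p, m) | p m. m \<in> F p} = {prod_encode (to_nat p, m) | p m. m \<in> G p}"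
  have "m \<in> F p \<longleftrightarrow> m \<in> G p" for p m
  proof -
    have "m \<in> H p \<longleftrightarrow> prod_encode (to_nat p, m) \<in> {prod_encode (to_nat p, m) | p m. m \<in> H p}"
      for H :: "'a \<Rightarrow> nat set"
      by auto
    then show ?thesis using eq by blast
  qed
  then show "F = G" by auto
qed

lemma sigma_sets_lepoll:
  fixes G :: "'a set set"
  assumes "G \<lesssim> (UNIV :: nat set set)"
  shows "sigma_sets \<Omega> G \<lesssim> (UNIV :: nat set set)"
proof -
  obtain g :: "nat set \<Rightarrow> 'a set" where g: "G \<subseteq> range g"
    using assms unfolding lepoll_iff by blast
  have "sigma_sets \<Omega> G \<subseteq> range (eval_code \<Omega> g)"
  proof
    fix A assume "A \<in> sigma_sets \<Omega> G"
    then show "A \<in> range (eval_code \<Omega> g)"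
    proof induction
      case (Basic A)
      then obtain b where "A = g b" using g by auto
      then have "A = eval_code \<Omega> g (Basic b)" by simp
      then show ?case by blast
    next
      case Empty
      have "{} = eval_code \<Omega> g Empty" by simp
      then show ?case by blast
    next
      case (Compl A)
      then obtain t where "A = eval_code \<Omega> g t" by blast
      then have "\<Omega> - A = eval_code \<Omega> g (Complement t)" by simp
      then show ?case by blast
    next
      case (Union A)
      then have "\<exists>t. A n = eval_code \<Omega> g t" for n by blast
      then obtain t where "A n = eval_code \<Omega> g (t n)" for n by metis
      then have "(\<Union>n. A n) = eval_code \<Omega> g (Countable_Union t)" by simp
      then show ?case by blast
    qed
  qed
  then have "sigma_sets \<Omega> G \<lesssim> (UNIV :: nat set sigma_code set)"
    by (rule subset_image_lepoll)
  also have "\<dots> \<lesssim> (UNIV :: nat set set)"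
  proof -
    have "inj (\<lambda>t. {prod_encode (to_nat p, m) | p m. m \<in> labels t p})"
      by (rule injI, rule labels_inject, rule injD[OF inj_graph_encoding])
    then show ?thesis unfolding lepoll_def by blast
  qed
  finally show ?thesis .
qed

text \<open>The generators of the product sigma-algebra are given by a coin and a set of truth
  values. Words are countable, so a tree amounts to a set of naturals.\<close>

lemma index_lepoll: "(UNIV :: (index \<times> bool set) set) \<lesssim> (UNIV :: nat set set)"
proof -
  define h :: "index \<times> bool set \<Rightarrow> nat set" where
    "h = (\<lambda>((W, w), A). {prod_encode (to_nat n, m) | n m.
            m \<in> (if n = 0 then to_nat ` W else if n = 1 then {to_nat w} else if n = (2::nat) then to_nat ` A else {})})"
  have "inj h"
  proof (rule injI)
    fix z z' assume eq: "h z = h z'"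
    obtain W w A where z: "z = ((W, w), A)" by (metis surj_pair)
    obtain W' w' A' where z': "z' = ((W', w'), A')" by (metis surj_pair)
    let ?F = "\<lambda>W w A n. if n = 0 then to_nat ` W else if n = 1 then {to_nat w} else if n = (2::nat) then to_nat ` A else {}"
    have F: "?F W w A = ?F W' w' A'"
      using eq unfolding h_def z z' by (intro injD[OF inj_graph_encoding]) simp
    have "to_nat ` W = to_nat ` W'" "to_nat w = to_nat w'" "to_nat ` A = to_nat ` A'"
      using fun_cong[OF F, of 0] fun_cong[OF F, of 1] fun_cong[OF F, of 2] by auto
    then show "z = z'" unfolding z z' by (simp add: inj_image_eq_iff)
  qed
  then show ?thesis unfolding lepoll_def by blast
qed

lemma sets_coins_lepoll: "sets coins \<lesssim> (UNIV :: real set)"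
proof -
  let ?G = "{{f :: index \<Rightarrow> bool. f i \<in> A} | i A. True}"
  have "?G = (\<lambda>(i, A). {f. f i \<in> A}) ` UNIV" by auto
  then have "?G \<lesssim> (UNIV :: nat set set)"
    using lepoll_trans[OF image_lepoll index_lepoll] by metis
  then have "sigma_sets UNIV ?G \<lesssim> (UNIV :: nat set set)"
    by (rule sigma_sets_lepoll)
  moreover have "sets coins = sigma_sets UNIV ?G"
    unfolding coins_def sets_PiM_single by (simp add: PiE_UNIV_domain)
  ultimately show ?thesis
    using nat_sets_eqpoll_reals lepoll_trans2 by metis
qed

text \<open>Each class modulo null sets gets one representative, which an injection of the
  sigma-algebra into the reals turns into a code. The events "heads" of different coins are
  inequivalent, which yields continuum many codes.\<close>

lemma ex_real_coding:
  obtains C :: "real set" and k :: "real \<Rightarrow> (index \<Rightarrow> bool) set" where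
    "C \<approx> (UNIV :: real set)"
    "\<And>r. r \<in> C \<Longrightarrow> k r \<in> sets coins"
    "\<And>A. A \<in> sets coins \<Longrightarrow> \<exists>r\<in>C. cost (sym_diff A (k r)) = 0"
    "\<And>r s. r \<in> C \<Longrightarrow> s \<in> C \<Longrightarrow> cost (sym_diff (k r) (k s)) = 0 \<Longrightarrow> r = s"
proof -
  obtain h :: "(index \<Rightarrow> bool) set \<Rightarrow> real" where h: "inj_on h (sets coins)"
    using sets_coins_lepoll unfolding lepoll_def by blast
  define null where "null A B \<longleftrightarrow> emeasure coins (sym_diff A B) = 0" for A B
  have cost0: "cost (sym_diff A B) = 0 \<longleftrightarrow> null A B" if "A \<in> sets coins" "B \<in> sets coins" for A B
    unfolding null_def using that by (intro cost_eq_0_iff) auto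
  have null_refl: "null A A" and null_sym: "null A B \<Longrightarrow> null B A" for A B
    by (simp_all add: null_def Un_commute)
  have null_trans: "null A D"
    if "null A B" "null B D" "A \<in> sets coins" "B \<in> sets coins" "D \<in> sets coins" for A B D
  proof -
    have "sym_diff A D \<subseteq> sym_diff A B \<union> sym_diff B D" by auto
    then have "cost (sym_diff A D) \<le> cost (sym_diff A B \<union> sym_diff B D)"
      using that by (intro cost_mono) auto
    also have "\<dots> \<le> cost (sym_diff A B) + cost (sym_diff B D)"
      using that by (intro cost_Un) auto
    also have "\<dots> = 0" using that cost0 by simp
    finally show ?thesis using cost0 that by simp
  qed
  define rep where "rep A = (SOME B. B \<in> sets coins \<and> null A B)" for A
  have rep: "rep A \<in> sets coins" "null A (rep A)" if "A \<in> sets coins" for A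
    using someI[of "\<lambda>B. B \<in> sets coins \<and> null A B" A] that null_refl unfolding rep_def by auto
  have rep_eq: "rep A = rep B" if "null A B" "A \<in> sets coins" "B \<in> sets coins" for A B
  proof -
    have "(D \<in> sets coins \<and> null A D) = (D \<in> sets coins \<and> null B D)" for D
      using that null_trans null_sym by blast
    then show ?thesis unfolding rep_def by simp
  qed
  define C where "C = h ` rep ` sets coins"
  define k where "k = the_inv_into (sets coins) h"
  have k: "k (h A) = A" if "A \<in> sets coins" for A
    unfolding k_def using that by (rule the_inv_into_f_f[OF h])
  have C: "\<exists>A\<in>sets coins. r = h (rep A) \<and> k r = rep A" if r: "r \<in> C" for r
  proof -
    obtain A where A: "A \<in> sets coins" "r = h (rep A)"
      using r unfolding C_def by blast
    then have "k r = rep A" using k[OF rep(1)] by simp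
    then show ?thesis using A by (intro bexI[of _ A] conjI)
  qed
  show thesis
  proof
    show "k r \<in> sets coins" if "r \<in> C" for r using C[OF that] rep by auto
    show "\<exists>r\<in>C. cost (sym_diff A (k r)) = 0" if "A \<in> sets coins" for A
    proof (rule bexI)
      show "cost (sym_diff A (k (h (rep A)))) = 0" using that rep k cost0 by simp
      show "h (rep A) \<in> C" using that by (simp add: C_def)
    qed
    show eq: "r = s" if "r \<in> C" "s \<in> C" "cost (sym_diff (k r) (k s)) = 0" for r s
    proof -
      from C[OF that(1)] obtain A where A: "A \<in> sets coins" "r = h (rep A)" "k r = rep A" by blast
      from C[OF that(2)] obtain B where B: "B \<in> sets coins" "s = h (rep B)" "k s = rep B" by blast
      have "null (rep A) (rep B)" using that(3) cost0 rep(1) A B by simp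
      then have "null A B" using null_trans null_sym rep A B by metis
      then show ?thesis using rep_eq A B by simp
    qed
    have "(UNIV :: nat set set) \<lesssim> C"
    proof -
      \<comment> \<open>These trees only serve to name continuum many different coins.\<close>
      define j :: "nat set \<Rightarrow> index" where "j N = ((\<lambda>n. [[n]]) ` N, [])" for N
      have "inj (\<lambda>n::nat. [[n]])" by (auto intro: injI)
      then have j: "inj j" by (auto intro!: injI simp: j_def inj_image_eq_iff)
      let ?H = "\<lambda>N. {x. x (j N)}"
      have "inj (\<lambda>N. h (rep (?H N)))"
      proof (rule injI, rule ccontr)
        fix N N' assume eq: "h (rep (?H N)) = h (rep (?H N'))" and ne: "N \<noteq> N'"
        have s: "?H N \<in> sets coins" "?H N' \<in> sets coins" by (rule coordinate_in_sets)+
        have "rep (?H N) = rep (?H N')"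
          using eq h rep(1)[OF s(1)] rep(1)[OF s(2)] by (simp add: inj_on_eq_iff)
        then have "null (?H N) (?H N')"
          using rep(2)[OF s(1)] rep(2)[OF s(2)] null_trans null_sym rep(1) s by metis
        have "j N \<noteq> j N'" using j ne by (auto dest: injD)
        \<comment> \<open>Heads for the first coin and tails for the second has measure 1/4 and lies
          in the symmetric difference.\<close>
        then have "{x. \<forall>i\<in>{j N, j N'}. x i = (i = j N)} \<subseteq> sym_diff (?H N) (?H N')" by auto
        then have "emeasure coins {x. \<forall>i\<in>{j N, j N'}. x i = (i = j N)} \<le> emeasure coins (sym_diff (?H N) (?H N'))"
          using s by (intro emeasure_mono) auto
        also have "\<dots> = 0" using \<open>null (?H N) (?H N')\<close> by (simp add: null_def)
        finally have "ennreal ((1/2) ^ card {j N, j N'}) \<le> 0"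
          by (subst (asm) emeasure_cylinder) auto
        moreover have "0 < (1/2::real) ^ card {j N, j N'}" by (rule zero_less_power) simp
        ultimately show False by simp
      qed
      moreover have "range (\<lambda>N. h (rep (?H N))) \<subseteq> C"
        unfolding C_def using coordinate_in_sets by blast
      ultimately show ?thesis unfolding lepoll_def by blast
    qed
    then have "(UNIV :: real set) \<lesssim> C"
      using nat_sets_eqpoll_reals eqpoll_sym lepoll_trans1 by blast
    then show "C \<approx> (UNIV :: real set)"
      by (rule lepoll_antisym[OF subset_imp_lepoll[OF subset_UNIV]])
  qed
qed

section \<open>The metric space\<close>

text \<open>\<open>C\<close> is a set of real codes for the classes of measurable sets modulo null sets, and \<open>k\<close> picks
  a representative of the class.\<close>

locale coding =
  fixes C :: "real set" and k :: "real \<Rightarrow> (index \<Rightarrow> bool) set"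
  assumes k_sets [simp]: "r \<in> C \<Longrightarrow> k r \<in> sets coins"
    and k_surj: "A \<in> sets coins \<Longrightarrow> \<exists>r\<in>C. cost (sym_diff A (k r)) = 0"
    and k_inj: "r \<in> C \<Longrightarrow> s \<in> C \<Longrightarrow> cost (sym_diff (k r) (k s)) = 0 \<Longrightarrow> r = s"
begin

definition d :: "real \<Rightarrow> real \<Rightarrow> real"
  where "d r s = enn2real (cost (sym_diff (k r) (k s)))"

lemma cost_sym_diff: "cost (sym_diff (k r) (k s)) = ennreal (d r s)"
  by (simp add: d_def ennreal_enn2real_if)

lemma d_nonneg [simp]: "0 \<le> d r s"
  by (simp add: d_def)

lemma cost_sym_diff_triangle:
  assumes "A \<in> sets coins" "B \<in> sets coins" "D \<in> sets coins"
  shows "cost (sym_diff A D) \<le> cost (sym_diff A B) + cost (sym_diff B D)"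
proof -
  have "sym_diff A D \<subseteq> sym_diff A B \<union> sym_diff B D" by auto
  then have "cost (sym_diff A D) \<le> cost (sym_diff A B \<union> sym_diff B D)"
    using assms by (intro cost_mono) auto
  also have "\<dots> \<le> cost (sym_diff A B) + cost (sym_diff B D)"
    using assms by (intro cost_Un) auto
  finally show ?thesis .
qed

sublocale Metric_space C d
proof
  show "d x y = d y x" for x y
    by (simp add: d_def Un_commute)
  show "d x y = 0 \<longleftrightarrow> x = y" if "x \<in> C" "y \<in> C" for x y
  proof
    assume "d x y = 0"
    then have "cost (sym_diff (k x) (k y)) = 0" by (simp add: cost_sym_diff)
    then show "x = y" by (rule k_inj[OF that])
  next
    assume "x = y"
    then show "d x y = 0" by (simp add: d_def cost_null)
  qed
  show "d x z \<le> d x y + d y z" if "x \<in> C" "y \<in> C" "z \<in> C" for x y z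
    using cost_sym_diff_triangle[of "k x" "k y" "k z"] that
    by (simp add: cost_sym_diff flip: ennreal_plus)
qed simp

definition rep :: "(index \<Rightarrow> bool) set \<Rightarrow> real"
  where "rep A = (SOME r. r \<in> C \<and> cost (sym_diff A (k r)) = 0)"

lemma rep: "A \<in> sets coins \<Longrightarrow> rep A \<in> C \<and> cost (sym_diff A (k (rep A))) = 0"
  unfolding rep_def by (rule someI_ex) (use k_surj in blast)

lemma rep_k: "r \<in> C \<Longrightarrow> rep (k r) = r"
  using rep[of "k r"] k_inj by (metis k_sets)

lemma cost_k_rep:
  assumes "A \<in> sets coins" "B \<in> sets coins"
  shows "cost (sym_diff (k (rep A)) B) \<le> cost (sym_diff A B)"
  using cost_sym_diff_triangle[of "k (rep A)" A B] rep[of A] assms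
  by (simp add: Un_commute)

lemma d_rep_le:
  assumes "A \<in> sets coins" "B \<in> sets coins"
  shows "ennreal (d (rep A) (rep B)) \<le> cost (sym_diff A B)"
proof -
  have "cost (sym_diff (k (rep A)) (k (rep B))) \<le> cost (sym_diff A (k (rep B)))"
    using rep[OF assms(2)] by (intro cost_k_rep assms) auto
  also have "\<dots> \<le> cost (sym_diff A B)"
    using cost_k_rep[of B A] assms by (simp add: Un_commute)
  finally show ?thesis by (simp add: cost_sym_diff)
qed

text \<open>Along a fast subsequence \<open>B\<close> the limit is the class of the set-theoretic
  liminf: where it differs from \<open>B n\<close>, some later step changes membership, and
  \<open>cost_UN\<close> sums the steps.\<close>

lemma complete: mcomplete
  unfolding mcomplete_def
proof (intro allI impI)
  fix \<sigma> assume \<sigma>: "MCauchy \<sigma>"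
  have inC: "\<sigma> n \<in> C" for n using \<sigma> by (auto simp: MCauchy_def)
  have "\<exists>N. \<forall>n\<ge>N. \<forall>n'\<ge>N. d (\<sigma> n) (\<sigma> n') < (1/2) ^ j" for j
  proof -
    have "\<forall>\<epsilon>>0. \<exists>N. \<forall>n n'. N \<le> n \<longrightarrow> N \<le> n' \<longrightarrow> d (\<sigma> n) (\<sigma> n') < \<epsilon>"
      using \<sigma> unfolding MCauchy_def by (rule conjunct2)
    moreover have "0 < (1/2::real) ^ j" by simp
    ultimately show ?thesis by meson
  qed
  then obtain N where N: "\<And>j n n'. n \<ge> N j \<Longrightarrow> n' \<ge> N j \<Longrightarrow> d (\<sigma> n) (\<sigma> n') < (1/2) ^ j"
    by metis
  \<comment> \<open>Partial sums give a monotone index function above \<open>N\<close>, so both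
    \<open>m j\<close> and \<open>m (Suc j)\<close> are at least \<open>N j\<close>.\<close>
  define m where "m j = (\<Sum>i\<le>j. N i)" for j
  have m: "N j \<le> m j" "N j \<le> m (Suc j)" for j
    by (simp_all add: m_def member_le_sum trans_le_add1)
  define B where "B j = k (\<sigma> (m j))" for j
  have B: "B j \<in> sets coins" for j by (simp add: B_def inC)
  have B_step: "cost (sym_diff (B j) (B (Suc j))) \<le> ennreal ((1/2) ^ j)" for j
    using N[OF m[of j]] by (simp add: B_def cost_sym_diff ennreal_leI)
  define A where "A = (\<Union>n. \<Inter>j. B (n + j))"
  have A: "A \<in> sets coins"
    unfolding A_def using B by (intro sets.countable_UN sets.countable_INT image_subsetI) auto
  have AB: "cost (sym_diff A (B n)) \<le> ennreal (2 * (1/2) ^ n)" for n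
  proof -
    have "sym_diff A (B n) \<subseteq> (\<Union>j. sym_diff (B (n + j)) (B (Suc (n + j))))"
    proof (rule subsetI, rule ccontr)
      fix x assume x: "x \<in> sym_diff A (B n)" and "x \<notin> (\<Union>j. sym_diff (B (n + j)) (B (Suc (n + j))))"
      then have step: "x \<in> B (Suc (n + j)) \<longleftrightarrow> x \<in> B (n + j)" for j by blast
      have const: "x \<in> B (n + j) \<longleftrightarrow> x \<in> B n" for j
        by (induction j) (simp_all add: step)
      have "x \<in> A \<longleftrightarrow> x \<in> B n"
      proof
        assume "x \<in> A"
        then obtain i where i: "\<And>j. x \<in> B (i + j)" by (auto simp: A_def)
        then have "x \<in> B (n + i)" by (metis add.commute)
        then show "x \<in> B n" using const by blast
      next
        assume "x \<in> B n"
        then show "x \<in> A" using const by (auto simp: A_def)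
      qed
      then show False using x by blast
    qed
    then have "cost (sym_diff A (B n)) \<le> cost (\<Union>j. sym_diff (B (n + j)) (B (Suc (n + j))))"
      using B by (intro cost_mono sets.countable_UN) auto
    also have "\<dots> \<le> (\<Sum>j. cost (sym_diff (B (n + j)) (B (Suc (n + j)))))"
      using B by (intro cost_UN) auto
    also have "\<dots> \<le> (\<Sum>j. ennreal ((1/2) ^ (n + j)))"
      by (intro suminf_le B_step) auto
    also have "\<dots> = ennreal (2 * (1/2) ^ n)"
    proof (rule suminf_ennreal_eq)
      have "(\<lambda>j. (1/2) ^ n * (1/2::real) ^ j) sums ((1/2) ^ n * (1 / (1 - 1/2)))"
        by (intro sums_mult geometric_sums) auto
      then show "(\<lambda>j. (1/2::real) ^ (n + j)) sums (2 * (1/2) ^ n)"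
        by (simp add: power_add algebra_simps)
    qed simp
    finally show ?thesis .
  qed
  have rA: "rep A \<in> C" using rep[OF A] by blast
  have lim: "d (\<sigma> i) (rep A) \<le> 3 * (1/2) ^ n" if "i \<ge> N n" for i n
  proof -
    have "ennreal (d (rep A) (rep (B n))) \<le> ennreal (2 * (1/2) ^ n)"
      using d_rep_le[OF A B] AB by (rule order_trans)
    moreover have "rep (B n) = \<sigma> (m n)" by (simp add: B_def rep_k inC)
    ultimately have "d (rep A) (\<sigma> (m n)) \<le> 2 * (1/2) ^ n" by simp
    moreover have "d (\<sigma> i) (\<sigma> (m n)) \<le> (1/2) ^ n" using N[OF that m(1)] by simp
    moreover have "d (\<sigma> i) (rep A) \<le> d (\<sigma> i) (\<sigma> (m n)) + d (rep A) (\<sigma> (m n))"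
      by (intro triangle' inC rA)
    ultimately show ?thesis by simp
  qed
  have "limitin mtopology \<sigma> (rep A) sequentially"
    unfolding limit_metric_sequentially
  proof (intro conjI allI impI rA)
    fix \<epsilon> :: real assume "0 < \<epsilon>"
    then obtain n where "(1/2::real) ^ n < \<epsilon> / 3"
      using real_arch_pow_inv[of "\<epsilon> / 3" "1/2"] by auto
    then show "\<exists>M. \<forall>i\<ge>M. \<sigma> i \<in> C \<and> d (\<sigma> i) (rep A) < \<epsilon>"
      using inC lim[of n] by (intro exI[of _ "N n"]) force
  qed
  then show "\<exists>x. limitin mtopology \<sigma> x sequentially" by blast
qed

section \<open>Chains between two points along a tree\<close>

definition lower :: "word set \<Rightarrow> word \<Rightarrow> nat \<Rightarrow> (index \<Rightarrow> bool) set"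
  where "lower W w i = {x. val x W w (length w) < i}"

text \<open>The switch from \<open>k a\<close> to \<open>k b\<close> is done on the first
  \<open>i\<close> pieces over \<open>w\<close>, so neighbours differ inside a single piece.\<close>

definition path :: "word set \<Rightarrow> real \<Rightarrow> real \<Rightarrow> word \<Rightarrow> nat \<Rightarrow> real"
  where "path W a b w i = rep ((k a - lower W w i) \<union> (k b \<inter> lower W w i))"

lemma lower_in_sets [simp]: "lower W w i \<in> sets coins"
proof -
  have "lower W w i = (\<Union>j\<in>{..<i}. piece ((W, w), j))"
    by (auto simp: lower_def piece.simps)
  then show ?thesis by (metis finite_lessThan piece_in_sets sets.finite_UN)
qed

context
  fixes a b assumes ab: "a \<in> C" "b \<in> C"
begin

lemma switch_in_sets: "(k a - lower W w i) \<union> (k b \<inter> lower W w i) \<in> sets coins"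
  using ab by (intro sets.Un sets.Diff sets.Int k_sets lower_in_sets)

lemma path_in_space: "path W a b w i \<in> C"
  unfolding path_def using rep[OF switch_in_sets] by blast

lemma path_0: "path W a b w 0 = a"
  using ab by (simp add: path_def lower_def rep_k)

lemma path_end: "path W a b w (2 ^ length w) = b"
  using ab val_less[of _ W w "length w"] by (simp add: path_def lower_def rep_k)

lemma path_step:
  assumes "admissible (W, w)"
  shows "d (path W a b w i) (path W a b w (Suc i)) \<le> (1/2) ^ length w"
proof -
  let ?P = "\<lambda>i. (k a - lower W w i) \<union> (k b \<inter> lower W w i)"
  have "ennreal (d (path W a b w i) (path W a b w (Suc i))) \<le> cost (sym_diff (?P i) (?P (Suc i)))"
    unfolding path_def by (intro d_rep_le switch_in_sets)
  also have "\<dots> \<le> cost (piece ((W, w), i))"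
    by (rule cost_mono[OF _ piece_in_sets]) (auto simp: lower_def piece.simps)
  also have "\<dots> \<le> ennreal ((1/2) ^ length w)"
    using cost_piece[OF assms] by simp
  finally show ?thesis by simp
qed

text \<open>Whichever letter is appended, piece \<open>i\<close> splits into the pieces
  \<open>2 * i\<close> and \<open>2 * i + 1\<close>, so the finer chain passes exactly through the
  coarser one.\<close>

lemma path_refine: "path W a b (w @ [c]) (2 * i) = path W a b w i"
proof -
  have "val x W (w @ [c]) (length w) = val x W w (length w)" for x
    using val_take[of "length w" "length w" x W "w @ [c]"] by simp
  then have "lower W (w @ [c]) (2 * i) = lower W w i"
    by (auto simp: lower_def of_bool_def)
  then show ?thesis by (simp add: path_def)
qed

end

section \<open>Separable retracts\<close>

lemma no_separable_retract:
  assumes S: "S \<subseteq> C" "a \<in> S" "b \<in> S" "a \<noteq> b"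
    and Q: "countable Q" "Q \<subseteq> S" "\<And>s \<epsilon>. s \<in> S \<Longrightarrow> 0 < \<epsilon> \<Longrightarrow> \<exists>q\<in>Q. d s q < \<epsilon>"
    and R: "\<And>x. x \<in> C \<Longrightarrow> R x \<in> S" "\<And>x. x \<in> S \<Longrightarrow> R x = x"
    and lip: "0 \<le> K" "\<And>x y. x \<in> C \<Longrightarrow> y \<in> C \<Longrightarrow> d (R x) (R y) \<le> K * d x y"
  shows False
proof -
  have ab: "a \<in> C" "b \<in> C" using S by auto
  define e where "e = from_nat_into Q"
  have "Q \<noteq> {}" using Q(3)[of a 1] S by auto
  then have e_range: "range e = Q" using Q(1) by (simp add: e_def)
  then have e: "e n \<in> C" for n using Q S by auto
  \<comment> \<open>\<open>K\<close> is the Lipschitz constant of \<open>R\<close>; the remainder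
    absorbs moving two neighbouring points into \<open>Q\<close>.\<close>
  define L where "L = K + 2"
  \<comment> \<open>\<open>good\<close> and \<open>fits\<close> mirror the hypotheses of
    \<open>no_dyadic_Lipschitz_curve\<close> for one chain and for two consecutive chains.\<close>
  define good where "good n c \<longleftrightarrow> (\<forall>i<2^n. d (e (c ! i)) (e (c ! Suc i)) < L * (1/2) ^ n) \<and>
     d a (e (c ! 0)) \<le> (1/4) ^ n \<and> d (e (c ! (2 ^ n))) b \<le> (1/4) ^ n" for n and c :: "nat list"
  define fits where "fits n c c' \<longleftrightarrow> (\<forall>i\<le>2^n. d (e (c ! i)) (e (c' ! (2 * i))) \<le> (1/4) ^ n)"
    for n and c c' :: "nat list"
  \<comment> \<open>Letter \<open>n\<close> of a word of \<open>T\<close> lists the numbers of the \<open>2 ^ n + 1\<close> points of a chain in \<open>Q\<close>.\<close>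
  define T where "T = {w. (\<forall>n<length w. good n (w ! n)) \<and> (\<forall>n. Suc n < length w \<longrightarrow> fits n (w ! n) (w ! Suc n))}"

  have no_branch: "\<not> (\<exists>\<beta>. \<forall>n. map \<beta> [0..<n] \<in> T)"
  proof
    assume "\<exists>\<beta>. \<forall>n. map \<beta> [0..<n] \<in> T"
    then obtain \<beta> where \<beta>: "\<And>n. map \<beta> [0..<n] \<in> T" by blast
    have good_\<beta>: "good n (\<beta> n)" for n
      using \<beta>[of "Suc n"] unfolding T_def by (auto simp: nth_append dest!: spec[of _ n])
    have fits_\<beta>: "fits n (\<beta> n) (\<beta> (Suc n))" for n
      using \<beta>[of "Suc (Suc n)"] unfolding T_def
      by (auto simp: nth_append dest!: spec[of _ n] simp del: upt_Suc)
    have "emeasure coins (sym_diff (k a) (k b)) = 0"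
    proof (rule no_dyadic_Lipschitz_curve[where q = "\<lambda>n i. k (e (\<beta> n ! i))" and L = L])
      show "cost (sym_diff (k (e (\<beta> n ! i))) (k (e (\<beta> n ! Suc i)))) < ennreal (L * (1/2) ^ n)"
        if "i < 2 ^ n" for n i
        using good_\<beta>[of n] that unfolding good_def cost_sym_diff by (simp add: ennreal_less_iff)
    qed (use good_\<beta> fits_\<beta> ab e in \<open>auto simp: good_def fits_def cost_sym_diff\<close>)
    then have "cost (sym_diff (k a) (k b)) = 0" by (rule cost_null)
    then show False using k_inj ab S by blast
  qed

  \<comment> \<open>The chain along \<open>T\<close> itself, pulled into \<open>S\<close> by the
    retraction.\<close>
  define y where "y w i = R (path T a b w i)" for w i
  have y: "y w i \<in> S" for w i by (simp add: y_def R path_in_space ab)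
  \<comment> \<open>The chain is rounded to \<open>Q\<close>. Half the tolerance is used, so that
    two roundings together stay within \<open>(1/4) ^ n\<close>.\<close>
  define letter where "letter w = map (\<lambda>i. SOME m. d (y w i) (e m) < (1/4) ^ length w / 2) [0..<Suc (2 ^ length w)]"
    for w :: word
  have letter: "d (y w i) (e (letter w ! i)) < (1/4) ^ length w / 2" if "i \<le> 2 ^ length w" for w i
  proof -
    have "\<exists>m. d (y w i) (e m) < (1/4) ^ length w / 2"
      using Q(3)[OF y, of "(1/4) ^ length w / 2" w i] e_range by auto
    from someI_ex[OF this] show ?thesis
      using that by (simp add: letter_def del: upt_Suc)
  qed
  have yC: "y w i \<in> C" for w i using y S by auto
  \<comment> \<open>Here \<open>R\<close> fixes \<open>a\<close> and \<open>b\<close>, so the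
    retracted chain still joins them.\<close>
  have y_0: "y w 0 = a" and y_end: "y w (2 ^ length w) = b" for w
    using ab R(2) S by (simp_all add: y_def path_0 path_end)
  have y_refine: "y (w @ [c]) (2 * i) = y w i" for w c i
    using ab by (simp add: y_def path_refine)
  \<comment> \<open>Admissibility enters through \<open>path_step\<close>: it is what bounds the
    cost of the pieces over \<open>w\<close>.\<close>
  have letter_good: "good (length w) (letter w)" if adm: "admissible (T, w)" for w
    unfolding good_def
  proof (intro conjI allI impI)
    let ?n = "length w"
    have quarter: "(1/4::real) ^ ?n \<le> (1/2) ^ ?n" by (intro power_mono) auto
    fix i :: nat assume i: "i < 2 ^ ?n"
    have "d (y w i) (y w (Suc i)) \<le> K * d (path T a b w i) (path T a b w (Suc i))"
      unfolding y_def by (intro lip path_in_space ab)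
    also have "\<dots> \<le> K * (1/2) ^ ?n"
      using lip(1) path_step[OF ab adm] by (intro mult_left_mono) auto
    finally have "d (y w i) (y w (Suc i)) \<le> K * (1/2) ^ ?n" .
    moreover have "d (e (letter w ! i)) (e (letter w ! Suc i)) \<le>
        d (e (letter w ! i)) (y w i) + d (y w i) (e (letter w ! Suc i))"
      by (intro triangle e yC)
    moreover have "d (y w i) (e (letter w ! Suc i)) \<le> d (y w i) (y w (Suc i)) + d (y w (Suc i)) (e (letter w ! Suc i))"
      by (intro triangle e yC)
    ultimately have "d (e (letter w ! i)) (e (letter w ! Suc i)) < K * (1/2) ^ ?n + (1/4) ^ ?n"
      using letter[of i w] letter[of "Suc i" w] i by (simp add: commute)
    also have "\<dots> \<le> L * (1/2) ^ ?n"
    proof -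
      have "0 \<le> (1/2::real) ^ ?n" by simp
      then show ?thesis using quarter unfolding L_def distrib_right by linarith
    qed
    finally show "d (e (letter w ! i)) (e (letter w ! Suc i)) < L * (1/2) ^ ?n" .
  next
    let ?n = "length w"
    have "(1/4::real) ^ ?n / 2 \<le> (1/4) ^ ?n" by simp
    then show "d a (e (letter w ! 0)) \<le> (1/4) ^ ?n" "d (e (letter w ! (2 ^ ?n))) b \<le> (1/4) ^ ?n"
      using letter[of 0 w] letter[of "2 ^ ?n" w] y_0[of w] y_end[of w]
      by (simp_all only: commute[of _ b]) linarith+
  qed
  have letter_fits: "fits (length w) (letter w) (letter (w @ [c]))" for w c
    unfolding fits_def
  proof (intro allI impI)
    let ?n = "length w"
    fix i :: nat assume i: "i \<le> 2 ^ ?n"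
    have "d (e (letter w ! i)) (e (letter (w @ [c]) ! (2 * i))) \<le>
        d (e (letter w ! i)) (y w i) + d (y w i) (e (letter (w @ [c]) ! (2 * i)))"
      by (intro triangle e yC)
    moreover have "d (y w i) (e (letter (w @ [c]) ! (2 * i))) < (1/4) ^ ?n / 2"
    proof -
      have "d (y w i) (e (letter (w @ [c]) ! (2 * i))) < (1/4) ^ Suc ?n / 2"
        using letter[of "2 * i" "w @ [c]"] i y_refine[of w c i] by simp
      also have "\<dots> \<le> (1/4) ^ ?n / 2" by simp
      finally show ?thesis .
    qed
    ultimately show "d (e (letter w ! i)) (e (letter (w @ [c]) ! (2 * i))) \<le> (1/4) ^ ?n"
      using letter[OF i] by (simp add: commute)
  qed

  define ws where "ws = rec_nat [] (\<lambda>_ w. w @ [letter w])"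
  have ws_0: "ws 0 = []" and ws_Suc: "ws (Suc n) = ws n @ [letter (ws n)]" for n
    by (simp_all add: ws_def)
  have ws_map: "ws n = map (\<lambda>j. letter (ws j)) [0..<n]" for n
    by (induction n) (simp_all add: ws_0 ws_Suc)
  have ws_length: "length (ws n) = n" for n by (subst ws_map) simp
  have ws_take: "take j (ws n) = ws (min j n)" for j n
    by (subst ws_map, subst (2) ws_map) (simp add: take_map min_def)
  have "ws n \<in> T" for n
  proof (induction n rule: less_induct)
    case (less n)
    have nth: "ws n ! j = letter (ws j)" if "j < n" for j
      using that by (subst ws_map) simp
    \<comment> \<open>The prefixes of \<open>ws j\<close> are earlier words of the sequence or
      \<open>ws j\<close> itself, all in \<open>T\<close> by induction.\<close>
    have "admissible (T, ws j)" if "j < n" for j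
      using less that no_branch by (simp add: admissible_def ws_take)
    then have "good j (letter (ws j))" if "j < n" for j
      using letter_good[of "ws j"] that by (simp add: ws_length)
    moreover have "fits j (letter (ws j)) (letter (ws (Suc j)))" for j
      using letter_fits[of "ws j" "letter (ws j)"] by (simp add: ws_length ws_Suc)
    ultimately show ?case by (simp add: T_def ws_length nth)
  qed
  then have "\<forall>n. map (\<lambda>j. letter (ws j)) [0..<n] \<in> T"
    by (simp flip: ws_map)
  then show False using no_branch by blast
qed

end

section \<open>Transfer to the metric type\<close>

theorem theorem1:
  shows "\<exists>M :: real metric.
           mcomplete_of M \<and>
           mspace M \<approx> (UNIV :: real set) \<and>
           (\<forall>S. closedin (mtopology_of M) S \<and>
                separable_space (subtopology (mtopology_of M) S) \<and>
                \<not> is_singleton S \<longrightarrow>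
                \<not> Lipschitz_retract_of S M)"
proof -
  obtain C :: "real set" and k where C: "C \<approx> (UNIV :: real set)" and k:
    "\<And>r. r \<in> C \<Longrightarrow> k r \<in> sets coins"
    "\<And>A. A \<in> sets coins \<Longrightarrow> \<exists>r\<in>C. cost (sym_diff A (k r)) = 0"
    "\<And>r s. r \<in> C \<Longrightarrow> s \<in> C \<Longrightarrow> cost (sym_diff (k r) (k s)) = 0 \<Longrightarrow> r = s"
    using ex_real_coding by blast
  interpret coding C k
    by unfold_locales (fact k)+
  have "C \<noteq> {}" using C by (metis UNIV_not_empty eqpoll_empty_iff_empty eqpoll_sym)
  have "\<not> Lipschitz_retract_of S (metric (C, d))"
    if closed: "closedin mtopology S" and sep: "separable_space (subtopology mtopology S)"
      and S: "\<not> is_singleton S" for S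
  proof
    assume "Lipschitz_retract_of S (metric (C, d))"
    then obtain R where R: "Lipschitz_continuous_map (metric (C, d)) (submetric (metric (C, d)) S) R"
      and fixed: "\<And>x. x \<in> S \<Longrightarrow> R x = x"
      unfolding Lipschitz_retract_of_def Lipschitz_retraction_def by blast
    have SC: "S \<subseteq> C" using closedin_subset[OF closed] by simp
    from R obtain K where RS: "\<And>x. x \<in> C \<Longrightarrow> R x \<in> S" and K: "0 < K"
      "\<And>x y. x \<in> C \<Longrightarrow> y \<in> C \<Longrightarrow> d (R x) (R y) \<le> K * d x y"
      unfolding Lipschitz_continuous_map_pos by auto
    \<comment> \<open>The empty set is no singleton either; it is excluded because \<open>R\<close>
      maps the nonempty space into \<open>S\<close>.\<close>
    obtain a where a: "a \<in> S" using RS \<open>C \<noteq> {}\<close> by blast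
    then obtain b where b: "b \<in> S" "a \<noteq> b"
      using S unfolding is_singleton_def by blast
    obtain Q where Q: "countable Q" "Q \<subseteq> S" "S \<subseteq> mtopology closure_of (S \<inter> Q)"
      using sep SC unfolding separable_space_def closure_of_subtopology
      by (auto simp: Int_absorb1)
    have "\<exists>q\<in>Q. d s q < \<epsilon>" if "s \<in> S" "0 < \<epsilon>" for s \<epsilon>
      using Q(3) that unfolding metric_closure_of by fastforce
    then show False
      using no_separable_retract[OF SC a b Q(1,2) _ RS fixed _ K(2)] K(1) by simp
  qed
  then show ?thesis
    using C complete by (intro exI[of _ "metric (C, d)"]) simp
qed

end
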